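(* Let $e=2.7182\dots$ be the Euler number. Then $$e-2=1+\cfrac{-1}{1+\cfrac{2}{1+\cfrac{-1}{1+\cfrac{3}{1+\cfrac{-1}{1+\cfrac{4}{1+\ddots}}}}}}.$$ That is, $e-2$ has the continued fraction expansion $b_0+\cfrac{a_1}{b_1+\cfrac{a_2}{b_2+\ddots}}$ with $b_n=1$ for all $n\ge0$, and $a_{2m-1}=-1$, $a_{2m}=m+1$ for all $m\ge1$.
   Context: For sequences of numbers $(a_n)_{n\ge1}$ and $(b_n)_{n\ge0}$, the $n$-th convergent $A_n/B_n$ of the (generalized) continued fraction $b_0+\cfrac{a_1}{b_1+\cfrac{a_2}{b_2+\ddots}}$ is its truncation at $a_n/b_n$. The sequences $(A_n)$, $(B_n)$ satisfy $A_n=b_nA_{n-1}+a_nA_{n-2}$ and $B_n=b_nB_{n-1}+a_nB_{n-2}$ for $n\ge1$, with $A_{-1}=1$, $A_0=b_0$, $B_{-1}=0$, $B_0=1$. A number $x$ has this continued fraction expansion (equivalently, $x$ equals the continued fraction) if $\lim_{n\to\infty}A_n/B_n=x$. *)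

theory Defs
  imports Complex_Main
begin

text \<open>
  Numerators and denominators of the convergents of
  \<open>b 0 + a 1 / (b 1 + a 2 / (b 2 + \<dots>))\<close>. The initial values with index \<open>-1\<close> (\<open>1\<close> for the
  numerators, \<open>0\<close> for the denominators) are substituted into the equations for index \<open>1\<close>.
  The value \<open>a 0\<close> is never used.
\<close>

fun gcf_num :: "(nat \<Rightarrow> 'a::comm_ring_1) \<Rightarrow> (nat \<Rightarrow> 'a) \<Rightarrow> nat \<Rightarrow> 'a" where
  "gcf_num a b 0 = b 0"
| "gcf_num a b (Suc 0) = b 1 * b 0 + a 1 * 1"
| "gcf_num a b (Suc (Suc n)) =
     b (Suc (Suc n)) * gcf_num a b (Suc n) + a (Suc (Suc n)) * gcf_num a b n"

fun gcf_denom :: "(nat \<Rightarrow> 'a::comm_ring_1) \<Rightarrow> (nat \<Rightarrow> 'a) \<Rightarrow> nat \<Rightarrow> 'a" where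
  "gcf_denom a b 0 = 1"
| "gcf_denom a b (Suc 0) = b 1 * 1 + a 1 * 0"
| "gcf_denom a b (Suc (Suc n)) =
     b (Suc (Suc n)) * gcf_denom a b (Suc n) + a (Suc (Suc n)) * gcf_denom a b n"

text \<open>
  The convergents are quotients of these sequences rather than nested divisions: an inner
  denominator of a truncation may vanish (as in \<open>1 + (-1) / (1 + 2 / (1 + (-1) / 1))\<close>) although
  the convergent is a finite number, and \<open>x / 0 = 0\<close> would then give the wrong value.
\<close>

definition gcf_convergent :: "(nat \<Rightarrow> 'a::field) \<Rightarrow> (nat \<Rightarrow> 'a) \<Rightarrow> nat \<Rightarrow> 'a" where
  "gcf_convergent a b n = gcf_num a b n / gcf_denom a b n"

text \<open>
  The first conjunct says that all but finitely many convergents are defined, so that the limit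
  does not depend on the convention \<open>x / 0 = 0\<close>.
\<close>

definition has_gcf_expansion ::
    "'a::real_normed_field \<Rightarrow> (nat \<Rightarrow> 'a) \<Rightarrow> (nat \<Rightarrow> 'a) \<Rightarrow> bool" where
  "has_gcf_expansion x a b \<longleftrightarrow>
     (\<forall>\<^sub>F n in sequentially. gcf_denom a b n \<noteq> 0) \<and> gcf_convergent a b \<longlonglongrightarrow> x"

end

theory Submission
  imports Defs
begin

text \<open>
  Let \<open>d n\<close> denote the \<open>n\<close>-th derangement number, that is, \<open>n!\<close> times the \<open>n\<close>-th partial sum of
  the exponential series at \<open>-1\<close>. Both \<open>n!\<close> and \<open>d n\<close> solve
  \<open>X (n + 2) = (n + 1) * (X (n + 1) + X n)\<close>, and hence so do all their linear combinations.
  The recurrence of the continued fraction is this one with a term inserted between any two: a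
  partial numerator \<open>-1\<close> undoes the addition of neighbours and a partial numerator
  \<open>m + 1\<close> supplies the growing factor (\<open>interleaved_solution\<close>). Comparing initial values,
  one finds \<open>X n = d n\<close> for the denominators and \<open>X n = n! - 2 * d n\<close> for the numerators; along
  the odd indices the convergents are therefore \<open>n! / d n - 2\<close>, and along the even indices they are
  mediants of two such quotients.

  Since \<open>d n / n!\<close> tends to \<open>exp (-1)\<close>, dividing numerators and denominators by the same
  factorials makes them tend to \<open>1 - 2 * exp (-1)\<close> and \<open>exp (-1)\<close>
  (\<open>interleaved_solution_limit\<close>). The second limit is not zero, so the denominators
  are eventually nonzero and the convergents tend to the quotient of the limits,
  which is \<open>exp 1 - 2\<close>.
\<close>

definition derangement_recurrence :: "(nat \<Rightarrow> real) \<Rightarrow> bool" where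
  "derangement_recurrence X \<longleftrightarrow> (\<forall>n. X (n + 2) = (real n + 1) * (X (n + 1) + X n))"

text \<open>
  By inclusion--exclusion, this is the number of permutations of \<open>n\<close> objects without a fixed point.
  The closed form displays the partial sums of the series for \<open>exp (-1)\<close>.
\<close>

definition derangements :: "nat \<Rightarrow> real" where
  "derangements n = fact n * (\<Sum>k\<le>n. (-1) ^ k / fact k)"

lemma derangements_Suc:
  "derangements (Suc n) = (real n + 1) * derangements n + (-1) ^ Suc n"
proof -
  have "derangements (Suc n)
      = fact (Suc n) * (\<Sum>k\<le>n. (-1) ^ k / fact k) + (-1) ^ Suc n"
    by (simp add: derangements_def distrib_left del: power_Suc fact_Suc)
  then show ?thesis
    by (simp add: derangements_def algebra_simps)
qed

lemma derangements_1 [simp]: "derangements (Suc 0) = 0"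
  by (simp add: derangements_def)

lemma derangements_2 [simp]: "derangements 2 = 1"
  by (simp add: derangements_def numeral_2_eq_2)

text \<open>
  The signs in two consecutive instances of the first-order recurrence cancel.
\<close>

lemma derangement_recurrence_derangements: "derangement_recurrence derangements"
  unfolding derangement_recurrence_def
  by (simp add: derangements_Suc algebra_simps)

lemma derangement_recurrence_fact: "derangement_recurrence fact"
  unfolding derangement_recurrence_def by (simp add: algebra_simps)

lemma derangement_recurrence_lincomb:
  assumes "derangement_recurrence X" "derangement_recurrence Y"
  shows "derangement_recurrence (\<lambda>n. X n + c * Y n)"
  using assms unfolding derangement_recurrence_def by (simp add: algebra_simps)

lemma derangements_over_fact_limit: "(\<lambda>n. derangements n / fact n) \<longlonglongrightarrow> exp (-1)"
proof -
  have "(\<lambda>k. (-1) ^ k / fact k :: real) sums exp (-1)"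
    using exp_converges[of "-1 :: real"] by (simp add: divide_inverse mult.commute)
  then show ?thesis
    by (simp add: sums_def_le derangements_def)
qed

text \<open>
  A partial numerator \<open>-1\<close> turns the pair \<open>X (m + 1) + X (m + 2)\<close>, \<open>X (m + 1)\<close> into \<open>X (m + 2)\<close>, and
  the following partial numerator \<open>m + 2\<close> produces
  \<open>X (m + 2) + (m + 2) * (X (m + 1) + X (m + 2))\<close>, which is \<open>X (m + 2) + X (m + 3)\<close>.
\<close>

lemma interleaved_solution:
  fixes U X :: "nat \<Rightarrow> real"
  assumes X: "derangement_recurrence X"
    and init: "U 0 = X 1 + X 2" "U 1 = X 2"
    and even_step: "\<And>m. U (2 * m + 2) = U (2 * m + 1) + (real m + 2) * U (2 * m)"
    and odd_step: "\<And>m. U (2 * m + 3) = U (2 * m + 2) - U (2 * m + 1)"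
  shows "U (2 * m) = X (m + 1) + X (m + 2)" and "U (2 * m + 1) = X (m + 2)"
proof -
  have "U (2 * m) = X (m + 1) + X (m + 2) \<and> U (2 * m + 1) = X (m + 2)"
  proof (induction m)
    case 0
    show ?case using init by (simp add: numeral_2_eq_2)
  next
    case (Suc m)
    have "X (m + 3) = (real m + 2) * (X (m + 2) + X (m + 1))"
      using X[unfolded derangement_recurrence_def, rule_format, of "m + 1"]
      by (simp add: numeral_2_eq_2 numeral_3_eq_3)
    with Suc.IH have "U (2 * m + 2) = X (m + 2) + X (m + 3)"
      using even_step[of m] by (simp add: algebra_simps)
    moreover from this have "U (2 * m + 3) = X (m + 3)"
      using Suc.IH odd_step[of m] by simp
    ultimately show ?case
      by (simp add: numeral_2_eq_2 numeral_3_eq_3)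
  qed
  then show "U (2 * m) = X (m + 1) + X (m + 2)" and "U (2 * m + 1) = X (m + 2)"
    by auto
qed

lemma LIMSEQ_even_odd:
  fixes f :: "nat \<Rightarrow> 'a::topological_space"
  assumes even: "(\<lambda>m. f (2 * m)) \<longlonglongrightarrow> L" and odd: "(\<lambda>m. f (2 * m + 1)) \<longlonglongrightarrow> L"
  shows "f \<longlonglongrightarrow> L"
proof (rule topological_tendstoI)
  fix S assume "open S" "L \<in> S"
  then obtain M N where M: "\<And>m. m \<ge> M \<Longrightarrow> f (2 * m) \<in> S"
    and N: "\<And>m. m \<ge> N \<Longrightarrow> f (2 * m + 1) \<in> S"
    using topological_tendstoD[OF even] topological_tendstoD[OF odd]
    unfolding eventually_sequentially by metis
  have "f n \<in> S" if "n \<ge> 2 * M + 2 * N + 1" for n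
  proof (cases "even n")
    case True
    then obtain m where "n = 2 * m" by blast
    with that M show ?thesis by simp
  next
    case False
    then obtain m where "n = 2 * m + 1" using oddE by blast
    with that N show ?thesis by simp
  qed
  then show "\<forall>\<^sub>F n in sequentially. f n \<in> S"
    unfolding eventually_sequentially by blast
qed

text \<open>
  The normalisation \<open>(m + 2)!\<close> serves both indices \<open>2 * m\<close> and \<open>2 * m + 1\<close>: at the even index the
  additional summand \<open>X (m + 1)\<close> is of the order of at most \<open>(m + 1)!\<close> and disappears in the limit.
\<close>

lemma interleaved_solution_limit:
  fixes U X :: "nat \<Rightarrow> real"
  assumes X: "derangement_recurrence X"
    and init: "U 0 = X 1 + X 2" "U 1 = X 2"
    and even_step: "\<And>m. U (2 * m + 2) = U (2 * m + 1) + (real m + 2) * U (2 * m)"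
    and odd_step: "\<And>m. U (2 * m + 3) = U (2 * m + 2) - U (2 * m + 1)"
    and lim: "(\<lambda>n. X n / fact n) \<longlonglongrightarrow> L"
  shows "(\<lambda>n. U n / fact (n div 2 + 2)) \<longlonglongrightarrow> L"
proof (rule LIMSEQ_even_odd)
  note U = interleaved_solution[OF X init even_step odd_step]
  have lim1: "(\<lambda>m. X (m + 1) / fact (m + 1)) \<longlonglongrightarrow> L"
    and lim2: "(\<lambda>m. X (m + 2) / fact (m + 2)) \<longlonglongrightarrow> L"
    using lim by (rule LIMSEQ_ignore_initial_segment)+
  show "(\<lambda>m. U (2 * m + 1) / fact ((2 * m + 1) div 2 + 2)) \<longlonglongrightarrow> L"
    using lim2 by (simp add: U(2)[simplified])
  have "(\<lambda>m. inverse (real (m + 2))) \<longlonglongrightarrow> 0"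
    using lim_inverse_n by (rule LIMSEQ_ignore_initial_segment)
  from tendsto_add[OF tendsto_mult[OF lim1 this] lim2]
  have "(\<lambda>m. X (m + 1) / fact (m + 1) * inverse (real (m + 2)) + X (m + 2) / fact (m + 2)) \<longlonglongrightarrow> L"
    by simp
  moreover have "X (m + 1) / fact (m + 1) * inverse (real (m + 2)) + X (m + 2) / fact (m + 2)
      = U (2 * m) / fact (2 * m div 2 + 2)" for m
  proof -
    have "fact (m + 2) = real (m + 2) * fact (m + 1)" by simp
    then have "X (m + 1) / fact (m + 1) * inverse (real (m + 2)) = X (m + 1) / fact (m + 2)"
      by (metis divide_divide_eq_left divide_inverse mult.commute)
    then show ?thesis by (simp add: U(1) add_divide_distrib del: fact_Suc)
  qed
  ultimately show "(\<lambda>m. U (2 * m) / fact (2 * m div 2 + 2)) \<longlonglongrightarrow> L"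
    by simp
qed

theorem theorem2:
  fixes a b :: "nat \<Rightarrow> real"
  assumes "\<And>n. b n = 1"
    and "\<And>m. m \<ge> 1 \<Longrightarrow> a (2 * m - 1) = -1"
    and "\<And>m. m \<ge> 1 \<Longrightarrow> a (2 * m) = real m + 1"
  shows "has_gcf_expansion (exp 1 - 2) a b"
proof -
  let ?A = "gcf_num a b" and ?B = "gcf_denom a b"
  let ?c = "\<lambda>n. fact (n div 2 + 2) :: real"
  let ?X = "\<lambda>n. fact n + (-2) * derangements n"
  have a_odd: "a (Suc (2 * m)) = -1" for m
    using assms(2)[of "m + 1"] by simp
  have a_even: "a (Suc (Suc (2 * m))) = real m + 2" for m
    using assms(3)[of "m + 1"] by simp
  have a_odd': "a (Suc (Suc (Suc (2 * m)))) = -1" for m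
    using a_odd[of "m + 1"] by simp

  have B: "(\<lambda>n. ?B n / ?c n) \<longlonglongrightarrow> exp (-1)"
  proof (rule interleaved_solution_limit[OF derangement_recurrence_derangements])
    show "?B (2 * m + 2) = ?B (2 * m + 1) + (real m + 2) * ?B (2 * m)" for m
      by (simp add: assms(1) a_even)
    show "?B (2 * m + 3) = ?B (2 * m + 2) - ?B (2 * m + 1)" for m
      by (simp add: numeral_3_eq_3 assms(1) a_odd')
  qed (simp_all add: assms(1) derangements_over_fact_limit)

  have A: "(\<lambda>n. ?A n / ?c n) \<longlonglongrightarrow> 1 - 2 * exp (-1)"
  proof (rule interleaved_solution_limit[where X = ?X])
    show "derangement_recurrence ?X"
      by (intro derangement_recurrence_lincomb derangement_recurrence_fact
          derangement_recurrence_derangements)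
    show "?A (2 * m + 2) = ?A (2 * m + 1) + (real m + 2) * ?A (2 * m)" for m
      by (simp add: assms(1) a_even)
    show "?A (2 * m + 3) = ?A (2 * m + 2) - ?A (2 * m + 1)" for m
      by (simp add: numeral_3_eq_3 assms(1) a_odd')
    have "(\<lambda>n. 1 - 2 * (derangements n / fact n)) \<longlonglongrightarrow> 1 - 2 * exp (-1)"
      by (intro tendsto_intros derangements_over_fact_limit)
    then show "(\<lambda>n. ?X n / fact n) \<longlonglongrightarrow> 1 - 2 * exp (-1)"
      by (simp add: diff_divide_distrib)
  qed (use a_odd[of 0] in \<open>simp_all add: assms(1)\<close>)

  have "\<forall>\<^sub>F n in sequentially. ?B n / ?c n \<noteq> 0"
    using B by (rule tendsto_imp_eventually_ne) simp
  then have "\<forall>\<^sub>F n in sequentially. ?B n \<noteq> 0"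
    by (rule eventually_mono) auto
  moreover have "gcf_convergent a b \<longlonglongrightarrow> exp 1 - 2"
  proof -
    have "(\<lambda>n. (?A n / ?c n) / (?B n / ?c n)) \<longlonglongrightarrow> (1 - 2 * exp (-1)) / exp (-1)"
      by (intro tendsto_divide A B) simp
    moreover have "(1 - 2 * exp (-1)) / exp (-1) = exp 1 - (2 :: real)"
      by (simp add: exp_minus field_simps)
    moreover have "(\<lambda>n. (?A n / ?c n) / (?B n / ?c n)) = gcf_convergent a b"
      by (simp add: gcf_convergent_def fun_eq_iff)
    ultimately show ?thesis by simp
  qed
  ultimately show ?thesis
    unfolding has_gcf_expansion_def by blast
qed

end
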